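(* For every nonnegative integer $n$, the following identity of polynomials in $x$ holds: $$L_n(x)=\sum_{k=0}^{n}\frac{(-n)_{k}}{2^{k}\,k!\,k!}\;{}_{2}F_{2}\!\left(\begin{array}{c}\frac{k-n}{2},\ \frac{k+1-n}{2}\\ \frac{k+1}{2},\ \frac{k+2}{2}\end{array}\Bigg|\,\frac14\right)H_{k}(x).$$
   Context: $(a)_0=1$ and $(a)_k=a(a+1)\cdots(a+k-1)$ denote the Pochhammer symbol. The generalized hypergeometric function is $${}_pF_q\!\left(\begin{array}{c}a_1,\dots,a_p\\ b_1,\dots,b_q\end{array}\Bigg|\,z\right)=\sum_{t=0}^{\infty}\frac{(a_1)_t\cdots(a_p)_t}{(b_1)_t\cdots(b_q)_t}\frac{z^t}{t!},$$ and all the series in the claim terminate, because one of the upper parameters is a nonpositive integer. The Laguerre polynomials are $$L_n(x)=\sum_{k=0}^n\frac{(-n)_k}{k!}\frac{x^k}{k!}.$$ The (physicists') Hermite polynomials are $$H_N(x)=N!\sum_{k=0}^{\lfloor N/2\rfloor}\frac{(-1)^k}{k!\,(N-2k)!}(2x)^{N-2k}.$$ *)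

theory Defs
  imports "HOL-Analysis.Analysis" "HOL-Computational_Algebra.Polynomial"
begin

(* pFq with upper parameters as and lower parameters bs (p and q are the list lengths).
   When some upper parameter is a nonpositive integer, only finitely many terms are
   nonzero and the series is the finite sum. *)
definition hypergeometric ::
    "'a::{banach, real_normed_field} list \<Rightarrow> 'a list \<Rightarrow> 'a \<Rightarrow> 'a" where
  "hypergeometric as bs z = eval_fps (fps_hypergeo as bs 1) z"

lemma hypergeometric_eq_suminf:
  "hypergeometric as bs z =
     (\<Sum>t. (\<Prod>a\<leftarrow>as. pochhammer a t) / (\<Prod>b\<leftarrow>bs. pochhammer b t) * (z ^ t / fact t))"
proof -
  have L: "foldl (\<lambda>r a. r * pochhammer a t) c xs = c * (\<Prod>a\<leftarrow>xs. pochhammer a t)"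
    for t and c :: 'a and xs
    by (induction xs arbitrary: c) (simp_all add: mult.assoc)
  show ?thesis
    unfolding hypergeometric_def eval_fps_def fps_hypergeo_nth L
    by (simp add: of_nat_fact field_simps)
qed

definition laguerre :: "nat \<Rightarrow> 'a::field_char_0 poly" where
  "laguerre n = (\<Sum>k=0..n. monom (pochhammer (- of_nat n) k / fact k * (1 / fact k)) k)"

definition hermite :: "nat \<Rightarrow> 'a::field_char_0 poly" where
  "hermite N =
     smult (fact N)
       (\<Sum>k=0..N div 2. smult ((-1) ^ k / (fact k * fact (N - 2 * k))) ([:0, 2:] ^ (N - 2 * k)))"

end

theory Submission
  imports Defs
begin

text \<open>Dividing \<open>H\<^sub>N\<close> by \<open>N!\<close> turns its definition into a convolution with the
  coefficients of \<open>exp (- t)\<close> in \<open>t\<close>, which is undone by convolving with those of \<open>exp t\<close>: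
  \<open>(2x)\<^sup>j / j! = (\<Sum>m\<le>j/2. H\<^sub>j\<^sub>-\<^sub>2\<^sub>m / (m! (j-2m)!))\<close>. Substituting this into the Laguerre
  polynomial and collecting the coefficient of \<open>H\<^sub>k\<close> leaves a sum over the indices \<open>j = k + 2m\<close>,
  and the duplication formula for the Pochhammer symbol identifies it with the \<open>2F2\<close> series.\<close>

lemma smult_sum_right: "smult c (\<Sum>i\<in>A. p i) = (\<Sum>i\<in>A. smult c (p i))"
  by (induction A rule: infinite_finite_induct) (simp_all add: smult_add_right)

text \<open>This is the coefficient of \<open>t ^ s\<close> in \<open>exp t * exp (- t) = 1\<close>;
  multiplied by \<open>fact s\<close> it becomes the binomial expansion of
  \<open>(1 - 1) ^ s\<close>.\<close>

lemma sum_alternating_inverse_fact: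
  "(\<Sum>i\<le>s. (-1) ^ (s - i) / (fact i * fact (s - i))) = (if s = 0 then 1 else 0 :: 'a::field_char_0)"
proof -
  have "(\<Sum>i\<le>s. (-1) ^ (s - i) / (fact i * fact (s - i))) =
      (\<Sum>i\<le>s. (-1) ^ i / (fact i * fact (s - i)) :: 'a)"
    by (rule sum.reindex_bij_witness[of _ "\<lambda>i. s - i" "\<lambda>i. s - i"]) (auto simp: mult.commute)
  also have "\<dots> = (\<Sum>i\<le>s. (-1) ^ i * of_nat (s choose i)) / fact s"
    by (auto simp: sum_divide_distrib binomial_fact field_simps intro!: sum.cong)
  also have "\<dots> = (if s = 0 then 1 else 0)"
    using choose_alternating_sum[of s, where 'a = 'a] by auto
  finally show ?thesis .
qed

lemma power_eq_sum_hermite: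
  "smult (1 / fact j) ([:0, 2:] ^ j) =
    (\<Sum>m\<le>j div 2. smult (1 / (fact m * fact (j - 2 * m))) (hermite (j - 2 * m)) :: 'a::field_char_0 poly)"
proof -
  define M where "M = j div 2"
  define a :: "nat \<Rightarrow> 'a poly" where "a i = smult (1 / fact i) ([:0, 2:] ^ i)" for i
  have h: "smult (1 / (fact m * fact (j - 2 * m))) (hermite (j - 2 * m)) =
      (\<Sum>k\<le>M - m. smult ((-1) ^ k / (fact m * fact k)) (a (j - 2 * (m + k))))"
    if "m \<le> M" for m
  proof -
    \<comment> \<open>Thus the Hermite sum stops exactly at \<open>m + k = M\<close>, and the double
      sum fills a whole triangle.\<close>
    have "(j - 2 * m) div 2 = M - m"
      by (simp add: M_def)
    moreover have "j - 2 * m - 2 * k = j - 2 * (m + k)" for k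
      by simp
    ultimately show ?thesis
      by (simp add: hermite_def a_def smult_sum_right atMost_atLeast0 mult_ac)
  qed
  have "(\<Sum>m\<le>M. smult (1 / (fact m * fact (j - 2 * m))) (hermite (j - 2 * m))) =
      (\<Sum>m\<le>M. \<Sum>k\<le>M - m. smult ((-1) ^ k / (fact m * fact k)) (a (j - 2 * (m + k))))"
    by (intro sum.cong refl h) auto
  also have "\<dots> = (\<Sum>(m, k)\<in>{(m, k). m + k \<le> M}.
      smult ((-1) ^ k / (fact m * fact k)) (a (j - 2 * (m + k))))"
    by (subst sum.Sigma) (auto intro!: sum.cong)
  \<comment> \<open>Along a diagonal \<open>m + k = s\<close> the polynomial factor is constant, so
    only the alternating sum of coefficients remains.\<close>
  also have "\<dots> = (\<Sum>s\<le>M. \<Sum>i\<le>s.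
      smult ((-1) ^ (s - i) / (fact i * fact (s - i))) (a (j - 2 * s)))"
    by (subst sum.triangle_reindex_eq) (auto intro!: sum.cong)
  also have "\<dots> = (\<Sum>s\<le>M. smult (if s = 0 then 1 else 0) (a (j - 2 * s)))"
    by (simp only: smult_sum[symmetric] sum_alternating_inverse_fact)
  also have "\<dots> = (\<Sum>s\<le>M. if s = 0 then a j else 0)"
    by (intro sum.cong) auto
  also have "\<dots> = a j"
    by simp
  finally show ?thesis
    by (simp add: M_def a_def)
qed

lemma monom_eq_sum_hermite:
  "monom c j =
    (\<Sum>m\<le>j div 2. smult (c * fact j / (2 ^ j * fact m * fact (j - 2 * m))) (hermite (j - 2 * m))
      :: 'a::field_char_0 poly)"
proof -
  have "[:0, 2:] = monom (2 :: 'a) 1"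
    by (simp add: monom_altdef)
  then have "monom c j = smult (c * fact j / 2 ^ j) (smult (1 / fact j) ([:0, 2:] ^ j))"
    by (simp add: monom_power smult_monom)
  then show ?thesis
    by (simp only: power_eq_sum_hermite smult_sum_right smult_smult) (simp add: mult.assoc)
qed

text \<open>Duplication merges the two upper and the two lower parameters; the factors
  \<open>2 ^ (2 * m)\<close> cancel. The series stops because \<open>k - n\<close> is a nonpositive
  integer.\<close>

lemma hypergeometric_2F2_eq_sum:
  assumes "k \<le> n"
  shows "hypergeometric
      [(real k - real n) / 2, (real k + 1 - real n) / 2] [(real k + 1) / 2, (real k + 2) / 2] z =
    (\<Sum>m\<le>(n - k) div 2.
      pochhammer (real k - real n) (2 * m) / pochhammer (real k + 1) (2 * m) * (z ^ m / fact m))"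
proof -
  have double: "pochhammer x (2 * m) = 2 ^ (2 * m) * pochhammer (x / 2) m * pochhammer ((x + 1) / 2) m"
    for x :: real and m
    using pochhammer_double[of "x / 2" m] by (simp add: add_divide_distrib)
  have "pochhammer ((real k - real n) / 2) m * pochhammer ((real k + 1 - real n) / 2) m /
        (pochhammer ((real k + 1) / 2) m * pochhammer ((real k + 2) / 2) m) =
      pochhammer (real k - real n) (2 * m) / pochhammer (real k + 1) (2 * m)" for m
  proof -
    have "(real k - real n + 1) / 2 = (real k + 1 - real n) / 2" "(real k + 1 + 1) / 2 = (real k + 2) / 2"
      by simp_all
    then show ?thesis
      by (simp only: double) simp
  qed
  then have "hypergeometric
      [(real k - real n) / 2, (real k + 1 - real n) / 2] [(real k + 1) / 2, (real k + 2) / 2] z =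
    (\<Sum>m. pochhammer (real k - real n) (2 * m) / pochhammer (real k + 1) (2 * m) * (z ^ m / fact m))"
    by (simp add: hypergeometric_eq_suminf)
  also have "\<dots> = (\<Sum>m\<le>(n - k) div 2.
      pochhammer (real k - real n) (2 * m) / pochhammer (real k + 1) (2 * m) * (z ^ m / fact m))"
  proof (rule suminf_finite)
    fix m assume "m \<notin> {..(n - k) div 2}"
    then have "n - k < 2 * m"
      by auto
    moreover have "real k - real n = - real (n - k)"
      using assms by simp
    ultimately have "pochhammer (real k - real n) (2 * m) = 0"
      by (simp only: pochhammer_of_nat_eq_0_iff)
    then show "pochhammer (real k - real n) (2 * m) / pochhammer (real k + 1) (2 * m) * (z ^ m / fact m) = 0"
      by simp
  qed simp
  finally show ?thesis .
qed

theorem theorem3p1: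
  fixes n :: nat
  shows "(laguerre n :: real poly) =
    (\<Sum>k=0..n.
       smult (pochhammer (- real n) k / (2 ^ k * fact k * fact k)
              * hypergeometric
                  [(real k - real n) / 2, (real k + 1 - real n) / 2]
                  [(real k + 1) / 2, (real k + 2) / 2]
                  (1 / 4))
         (hermite k))"
proof -
  \<comment> \<open>The weight of \<open>hermite (j - 2 * m)\<close> in the degree \<open>j\<close>
    term of \<open>laguerre n\<close>; one of the two factors \<open>fact j\<close> has
    cancelled.\<close>
  define c where "c j m = pochhammer (- real n) j / (fact j * 2 ^ j * fact m * fact (j - 2 * m))" for j m
  have coeff: "(\<Sum>m\<le>(n - k) div 2. c (k + 2 * m) m) =
      pochhammer (- real n) k / (2 ^ k * fact k * fact k)
        * hypergeometric
            [(real k - real n) / 2, (real k + 1 - real n) / 2]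
            [(real k + 1) / 2, (real k + 2) / 2] (1 / 4)" if "k \<le> n" for k
  proof -
    have "c (k + 2 * m) m = pochhammer (- real n) k / (2 ^ k * fact k * fact k) *
        (pochhammer (real k - real n) (2 * m) / pochhammer (real k + 1) (2 * m) * ((1 / 4) ^ m / fact m))"
      for m
    proof -
      \<comment> \<open>Both symbols of length \<open>k + 2 * m\<close> are split after
        \<open>k\<close> factors; \<open>2 ^ (k + 2 * m) = 2 ^ k * 4 ^ m\<close> supplies the
        argument \<open>1 / 4\<close>.\<close>
      have "fact (k + 2 * m) = fact k * pochhammer (real k + 1) (2 * m)"
        using pochhammer_product'[of "1 :: real" k "2 * m"] by (simp add: pochhammer_fact add.commute)
      moreover have "pochhammer (- real n) (k + 2 * m) =
          pochhammer (- real n) k * pochhammer (real k - real n) (2 * m)"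
        using pochhammer_product'[of "- real n" k "2 * m"] by (simp add: add.commute)
      ultimately show ?thesis
        by (simp add: c_def power_add power_mult power_divide)
    qed
    then show ?thesis
      using that by (simp add: hypergeometric_2F2_eq_sum sum_distrib_left)
  qed
  have "laguerre n = (\<Sum>j\<le>n. \<Sum>m\<le>j div 2. smult (c j m) (hermite (j - 2 * m)))"
    unfolding laguerre_def atMost_atLeast0 c_def
    by (subst monom_eq_sum_hermite) (simp add: atMost_atLeast0 mult.assoc)
  also have "\<dots> = (\<Sum>k\<le>n. \<Sum>m\<le>(n - k) div 2. smult (c (k + 2 * m) m) (hermite k))"
    unfolding sum.Sigma[OF finite_atMost ballI[OF finite_atMost]]
    \<comment> \<open>Truncated subtraction is harmless here, since \<open>m \<le> j div 2\<close>
      gives \<open>2 * m \<le> j\<close>.\<close>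
    by (rule sum.reindex_bij_witness[of _ "\<lambda>(k, m). (k + 2 * m, m)" "\<lambda>(j, m). (j - 2 * m, m)"]) auto
  also have "\<dots> = (\<Sum>k\<le>n. smult (\<Sum>m\<le>(n - k) div 2. c (k + 2 * m) m) (hermite k))"
    by (simp add: smult_sum)
  finally show ?thesis
    by (simp add: coeff atLeast0AtMost)
qed

end
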